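(* $\kappa(\mathbb{L})\le\mathfrak{h}$ and $\kappa(\mathbb{M})\le\mathfrak{h}$.
   Context: A tree on ${}^{<\omega}\omega$ is a nonempty subset closed under initial segments; $Succ_p(s)=\{n:s^\frown n\in p\}$. Laver forcing $\mathbb{L}$ is the set of trees $p$ with a stem (maximal node comparable with all nodes) such that $Succ_p(s)$ is infinite for all $s\in p$ extending the stem; Miller forcing $\mathbb{M}$ is the set of trees $p$ with a stem such that every $s\in p$ has an extension $t\in p$ with $Succ_p(t)$ infinite; both ordered by inclusion. For a forcing $P$, $\kappa(P)$ is the least cardinal to which forcing with $P$ collapses the continuum, i.e. the least cardinal $\kappa$ such that $P$ forces that there is a surjection from $\kappa$ onto $\mathfrak{c}$ of the ground model. $\mathfrak{h}$ is the least cardinality of a family of maximal antichains of $\mathcal{P}(\omega)/\mathrm{fin}$ without a common refinement. *)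

theory Defs
  imports "HOL-Library.Sublist" "HOL-Library.Infinite_Set"
begin

unbundle cardinal_syntax

section \<open>Least cardinals\<close>

text \<open>Cardinals are cardinal orders, compared across types by \<open>\<le>o\<close>. A least element of a set of
  cardinals is unique up to \<open>=o\<close>.\<close>

definition least_card :: "'a rel set \<Rightarrow> 'a rel" where
  "least_card C = (SOME r. r \<in> C \<and> (\<forall>r'\<in>C. r \<le>o r'))"

lemma least_card:
  assumes "C \<noteq> {}" and "\<forall>r\<in>C. Card_order r"
  shows "least_card C \<in> C" and "r \<in> C \<Longrightarrow> least_card C \<le>o r"
proof -
  have "\<forall>r\<in>C. Well_order r"
    using assms(2) by (auto simp: card_order_on_def)
  then have "\<exists>r. r \<in> C \<and> (\<forall>r'\<in>C. r \<le>o r')"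
    using exists_minim_Well_order[of C] assms(1) by blast
  then have *: "least_card C \<in> C \<and> (\<forall>r'\<in>C. least_card C \<le>o r')"
    unfolding least_card_def by (rule someI_ex)
  then show "least_card C \<in> C" and "r \<in> C \<Longrightarrow> least_card C \<le>o r"
    by blast+
qed


section \<open>The Boolean algebra of sets of natural numbers modulo finite sets\<close>

quotient_type pfin = "nat set" / "\<lambda>A B. finite ((A - B) \<union> (B - A))"
proof (rule equivpI)
  show "reflp (\<lambda>A B :: nat set. finite ((A - B) \<union> (B - A)))"
    by (auto intro: reflpI)
  show "symp (\<lambda>A B :: nat set. finite ((A - B) \<union> (B - A)))"
    by (auto intro: sympI)
  show "transp (\<lambda>A B :: nat set. finite ((A - B) \<union> (B - A)))"
  proof (rule transpI)
    fix A B C :: "nat set"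
    assume "finite ((A - B) \<union> (B - A))" and "finite ((B - C) \<union> (C - B))"
    then have "finite (((A - B) \<union> (B - A)) \<union> ((B - C) \<union> (C - B)))"
      by simp
    then show "finite ((A - C) \<union> (C - A))"
      by (rule finite_subset[rotated]) blast
  qed
qed

instantiation pfin :: boolean_algebra
begin

lift_definition bot_pfin :: pfin is "{}" .

lift_definition top_pfin :: pfin is UNIV .

lift_definition uminus_pfin :: "pfin \<Rightarrow> pfin" is uminus
  by (erule finite_subset[rotated]) blast

lift_definition inf_pfin :: "pfin \<Rightarrow> pfin \<Rightarrow> pfin" is "(\<inter>)"
  by (drule (1) finite_UnI, erule finite_subset[rotated]) blast

lift_definition sup_pfin :: "pfin \<Rightarrow> pfin \<Rightarrow> pfin" is "(\<union>)"
  by (drule (1) finite_UnI, erule finite_subset[rotated]) blast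

lift_definition minus_pfin :: "pfin \<Rightarrow> pfin \<Rightarrow> pfin" is "(-)"
  by (drule (1) finite_UnI, erule finite_subset[rotated]) blast

lift_definition less_eq_pfin :: "pfin \<Rightarrow> pfin \<Rightarrow> bool" is "\<lambda>A B. finite (A - B)"
proof -
  fix A A' B B' :: "nat set"
  assume "finite ((A - A') \<union> (A' - A))" and "finite ((B - B') \<union> (B' - B))"
  then have *: "finite (((A - A') \<union> (A' - A)) \<union> ((B - B') \<union> (B' - B)))" (is "finite ?D")
    by simp
  have "finite (A' - B')" if "finite (A - B)"
    by (rule finite_subset[of _ "?D \<union> (A - B)"]) (use * that in auto)
  moreover have "finite (A - B)" if "finite (A' - B')"
    by (rule finite_subset[of _ "?D \<union> (A' - B')"]) (use * that in auto)
  ultimately show "finite (A - B) = finite (A' - B')"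
    by blast
qed

definition less_pfin :: "pfin \<Rightarrow> pfin \<Rightarrow> bool" where
  "less_pfin x y \<longleftrightarrow> x \<le> y \<and> \<not> y \<le> x"

instance
proof
  fix x y z :: pfin
  show "(x < y) = (x \<le> y \<and> \<not> y \<le> x)"
    by (rule less_pfin_def)
  show "x \<le> x"
    by transfer simp
  show "x \<le> z" if "x \<le> y" "y \<le> z"
    using that by transfer (drule (1) finite_UnI, erule finite_subset[rotated], blast)
  show "x = y" if "x \<le> y" "y \<le> x"
    using that by transfer simp
  show "inf x y \<le> x"
    by transfer (rule finite_subset[of _ "{}"], auto)
  show "inf x y \<le> y"
    by transfer (rule finite_subset[of _ "{}"], auto)
  show "x \<le> inf y z" if "x \<le> y" "x \<le> z"
    using that by transfer (drule (1) finite_UnI, erule finite_subset[rotated], blast)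
  show "x \<le> sup x y"
    by transfer (rule finite_subset[of _ "{}"], auto)
  show "y \<le> sup x y"
    by transfer (rule finite_subset[of _ "{}"], auto)
  show "sup y z \<le> x" if "y \<le> x" "z \<le> x"
    using that by transfer (drule (1) finite_UnI, erule finite_subset[rotated], blast)
  show "bot \<le> x"
    by transfer simp
  show "x \<le> top"
    by transfer simp
  show "sup x (inf y z) = inf (sup x y) (sup x z)"
    by transfer (rule finite_subset[of _ "{}"], auto)
  show "inf x (- x) = bot"
    by transfer simp
  show "sup x (- x) = top"
    by transfer simp
  show "x - y = inf x (- y)"
    by transfer (rule finite_subset[of _ "{}"], auto)
qed

end


section \<open>The cardinal \<open>\<hh>\<close>\<close>

definition antichain :: "'a::boolean_algebra set \<Rightarrow> bool" where
  "antichain A \<longleftrightarrow> bot \<notin> A \<and> (\<forall>a\<in>A. \<forall>b\<in>A. a \<noteq> b \<longrightarrow> inf a b = bot)"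

definition max_antichain :: "'a::boolean_algebra set \<Rightarrow> bool" where
  "max_antichain A \<longleftrightarrow> antichain A \<and> (\<forall>B. antichain B \<longrightarrow> A \<subseteq> B \<longrightarrow> B = A)"

definition refines :: "'a::boolean_algebra set \<Rightarrow> 'a set \<Rightarrow> bool" where
  "refines A B \<longleftrightarrow> (\<forall>a\<in>A. \<exists>b\<in>B. a \<le> b)"

definition common_refinement :: "'a::boolean_algebra set \<Rightarrow> 'a set set \<Rightarrow> bool" where
  "common_refinement R H \<longleftrightarrow> max_antichain R \<and> (\<forall>A\<in>H. refines R A)"

definition cardinal_h :: "pfin set rel" ("\<hh>") where
  "\<hh> = least_card {|H| | H :: pfin set set.
     (\<forall>A\<in>H. max_antichain A) \<and> (\<nexists>R. common_refinement R H)}"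


section \<open>The forcing relation\<close>

text \<open>Statements of the forcing language are represented by the set of conditions forcing them,
  so the clauses of the recursive definition of the forcing relation become operations on
  predicates on conditions. Negation, conjunction and the existential quantifier are primitive.
  Existential quantification is over a ground model class of names for the objects in question: the
  check names of the elements of a ground model set, or the names for subsets of a ground model set.
  A name \<open>{(\<check>a, p), \<dots>}\<close> for a subset of a ground model set is represented as a set of
  pairs of type \<open>'a \<times> 'p\<close>; every subset, in the extension, of a ground model set has such a name.\<close>

type_synonym 'p statement = "'p \<Rightarrow> bool"

context
  fixes P :: "'p set" and le :: "'p \<Rightarrow> 'p \<Rightarrow> bool"
begin

definition dense_below :: "('p \<Rightarrow> bool) \<Rightarrow> 'p \<Rightarrow> bool" where
  "dense_below D p \<longleftrightarrow> (\<forall>q\<in>P. le q p \<longrightarrow> (\<exists>r\<in>P. le r q \<and> D r))"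

definition names :: "'a set \<Rightarrow> ('a \<times> 'p) set set" where
  "names A = Pow (A \<times> P)"

definition fmem :: "'a \<Rightarrow> ('a \<times> 'p) set \<Rightarrow> 'p statement" where
  "fmem a \<tau> = dense_below (\<lambda>q. \<exists>s. (a, s) \<in> \<tau> \<and> le q s)"

text \<open>Equality of check names is decided by the ground model.\<close>

definition feq :: "'a \<Rightarrow> 'a \<Rightarrow> 'p statement" where
  "feq a b = (\<lambda>p. a = b)"

definition fnot :: "'p statement \<Rightarrow> 'p statement" where
  "fnot \<phi> = (\<lambda>p. \<not> (\<exists>q\<in>P. le q p \<and> \<phi> q))"

definition fand :: "'p statement \<Rightarrow> 'p statement \<Rightarrow> 'p statement" where
  "fand \<phi> \<psi> = (\<lambda>p. \<phi> p \<and> \<psi> p)"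

definition fex :: "'x set \<Rightarrow> ('x \<Rightarrow> 'p statement) \<Rightarrow> 'p statement" where
  "fex X \<phi> = dense_below (\<lambda>q. \<exists>x\<in>X. \<phi> x q)"

definition fimp :: "'p statement \<Rightarrow> 'p statement \<Rightarrow> 'p statement" where
  "fimp \<phi> \<psi> = fnot (fand \<phi> (fnot \<psi>))"

definition fall :: "'x set \<Rightarrow> ('x \<Rightarrow> 'p statement) \<Rightarrow> 'p statement" where
  "fall X \<phi> = fnot (fex X (\<lambda>x. fnot (\<phi> x)))"

definition ffunction :: "'a set \<Rightarrow> 'b set \<Rightarrow> (('a \<times> 'b) \<times> 'p) set \<Rightarrow> 'p statement" where
  "ffunction A B f =
     fand (fall A (\<lambda>a. fex B (\<lambda>b. fmem (a, b) f)))
          (fall A (\<lambda>a. fall B (\<lambda>b. fall B (\<lambda>b'.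
             fimp (fand (fmem (a, b) f) (fmem (a, b') f)) (feq b b')))))"

definition fsurjection :: "'a set \<Rightarrow> 'b set \<Rightarrow> (('a \<times> 'b) \<times> 'p) set \<Rightarrow> 'p statement" where
  "fsurjection A B f =
     fand (ffunction A B f) (fall B (\<lambda>b. fex A (\<lambda>a. fmem (a, b) f)))"

definition forced :: "'p statement \<Rightarrow> bool" where
  "forced \<phi> \<longleftrightarrow> (\<forall>p\<in>P. \<phi> p)"

definition collapses :: "'b rel \<Rightarrow> 'a rel \<Rightarrow> bool" where
  "collapses c r \<longleftrightarrow>
     forced (fex (names (Field r \<times> Field c)) (fsurjection (Field r) (Field c)))"

text \<open>The cardinals in question are at most the continuum, so it suffices to consider cardinal
  orders on sets of subsets of \<open>\<omega>\<close>.\<close>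

definition kappa :: "nat set rel" where
  "kappa = least_card {r :: nat set rel. Card_order r \<and> collapses |UNIV :: nat set set| r}"

end


section \<open>Laver and Miller forcing\<close>

definition tree :: "nat list set \<Rightarrow> bool" where
  "tree p \<longleftrightarrow> p \<noteq> {} \<and> (\<forall>t\<in>p. \<forall>s. prefix s t \<longrightarrow> s \<in> p)"

definition Succ :: "nat list set \<Rightarrow> nat list \<Rightarrow> nat set" where
  "Succ p s = {n. s @ [n] \<in> p}"

definition comparable_node :: "nat list set \<Rightarrow> nat list \<Rightarrow> bool" where
  "comparable_node p s \<longleftrightarrow> s \<in> p \<and> (\<forall>t\<in>p. prefix s t \<or> prefix t s)"

definition is_stem :: "nat list set \<Rightarrow> nat list \<Rightarrow> bool" where
  "is_stem p s \<longleftrightarrow>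
     comparable_node p s \<and> (\<forall>t. comparable_node p t \<longrightarrow> prefix s t \<longrightarrow> t = s)"

definition laver :: "nat list set set" where
  "laver = {p. tree p \<and> (\<exists>s. is_stem p s \<and> (\<forall>t\<in>p. prefix s t \<longrightarrow> infinite (Succ p t)))}"

definition miller :: "nat list set set" where
  "miller = {p. tree p \<and> (\<exists>s. is_stem p s) \<and>
     (\<forall>s\<in>p. \<exists>t\<in>p. prefix s t \<and> infinite (Succ p t))}"


section \<open>The least cardinals exist\<close>

lemma collapses_refl:
  assumes refl: "\<And>p. p \<in> P \<Longrightarrow> le p p" and trans: "\<And>p q r. le p q \<Longrightarrow> le q r \<Longrightarrow> le p r"
  shows "collapses P le r r"
proof -
  let ?f = "{((a, a), p) | a p. a \<in> Field r \<and> p \<in> P}"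
  have allI': "\<And>p. p \<in> P \<Longrightarrow> fall P le X \<phi> p" if "\<And>x p. x \<in> X \<Longrightarrow> p \<in> P \<Longrightarrow> \<phi> x p"
    for X :: "'x set" and \<phi>
    unfolding fall_def fex_def dense_below_def fnot_def using that refl by meson
  have impI': "\<And>p. p \<in> P \<Longrightarrow> fimp P le \<phi> \<psi> p" if "\<And>p. p \<in> P \<Longrightarrow> \<phi> p \<Longrightarrow> \<psi> p" for \<phi> \<psi>
    unfolding fimp_def fand_def fnot_def using that refl by meson
  have mem: "fmem P le (a, b) ?f p \<longleftrightarrow> a = b" if "p \<in> P" "a \<in> Field r" for a b p
    using that refl trans unfolding fmem_def dense_below_def by blast
  have total: "fex P le (Field r) (\<lambda>b. fmem P le (a, b) ?f) p"
    and onto: "fex P le (Field r) (\<lambda>b. fmem P le (b, a) ?f) p" if "p \<in> P" "a \<in> Field r" for a p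
    unfolding fex_def dense_below_def using that refl mem by blast+
  have "fsurjection P le (Field r) (Field r) ?f p" if "p \<in> P" for p
    unfolding fsurjection_def ffunction_def fand_def
    by (intro conjI allI' impI' that total onto) (auto simp: mem feq_def)
  moreover have "?f \<in> names P (Field r \<times> Field r)"
    by (auto simp: names_def)
  ultimately show ?thesis
    unfolding collapses_def forced_def fex_def dense_below_def using refl by blast
qed

lemma kappa_welldefined:
  assumes "\<And>p. p \<in> P \<Longrightarrow> le p p" and "\<And>p q r. le p q \<Longrightarrow> le q r \<Longrightarrow> le p r"
  shows "Card_order (kappa P le)" "collapses P le |UNIV :: nat set set| (kappa P le)"
    and "Card_order r \<Longrightarrow> collapses P le |UNIV :: nat set set| r \<Longrightarrow> kappa P le \<le>o (r :: nat set rel)"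
proof -
  let ?C = "{r :: nat set rel. Card_order r \<and> collapses P le |UNIV :: nat set set| r}"
  have "collapses P le |UNIV :: nat set set| |UNIV :: nat set set|"
    by (rule collapses_refl) (fact assms(1), fact assms(2))
  then have "|UNIV :: nat set set| \<in> ?C"
    using card_of_Card_order by simp
  then have ne: "?C \<noteq> {}"
    by blast
  have card: "\<forall>r\<in>?C. Card_order r"
    by simp
  note * = least_card[OF ne card, folded kappa_def]
  show "Card_order (kappa P le)" "collapses P le |UNIV :: nat set set| (kappa P le)"
    using *(1) by simp_all
  show "kappa P le \<le>o r" if "Card_order r" "collapses P le |UNIV :: nat set set| r"
    using *(2) that by simp
qed

lemma pfin_split:
  fixes x :: pfin
  assumes "x \<noteq> bot"
  obtains y where "y \<noteq> bot" "\<not> x \<le> y" "\<not> x \<le> - y"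
proof -
  have "\<exists>y :: pfin. y \<noteq> bot \<and> \<not> x \<le> y \<and> \<not> x \<le> - y"
    using assms
  proof transfer
    fix A :: "nat set"
    assume "\<not> finite (A - {} \<union> ({} - A))"
    then have inf: "infinite A"
      by simp
    let ?B = "enumerate A ` {n. even n}"
    have inj: "inj (enumerate A)"
      using inf by (simp add: strict_mono_enumerate strict_mono_imp_inj_on)
    have evens: "infinite {n :: nat. even n}" "infinite {n :: nat. odd n}"
      unfolding infinite_nat_iff_unbounded_le
      by (metis even_Suc le_SucI mem_Collect_eq order_refl)+
    have "?B \<subseteq> A" "enumerate A ` {n. odd n} \<subseteq> A - ?B"
      using inf enumerate_in_set inj by (auto simp: inj_eq)
    moreover have "infinite ?B" "infinite (enumerate A ` {n. odd n})"
      using evens inj by (meson finite_imageD inj_on_subset subset_UNIV)+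
    ultimately have "?B \<subseteq> A \<and> infinite ?B \<and> infinite (A - ?B)"
      by (meson finite_subset)
    then obtain B where B: "B \<subseteq> A" "infinite B" "infinite (A - B)"
      by blast
    then have "A - - B = B"
      by blast
    with B show "\<exists>B. \<not> finite (B - {} \<union> ({} - B)) \<and> \<not> finite (A - B) \<and> \<not> finite (A - - B)"
      by (intro exI[of _ B]) simp
  qed
  with that show ?thesis
    by blast
qed

lemma cardinal_h_welldefined:
  fixes H :: "pfin set set"
  shows "\<exists>H. (\<forall>A\<in>H. max_antichain A) \<and> (\<nexists>R. common_refinement R H) \<and> \<hh> = |H|"
    and "\<lbrakk>\<forall>A\<in>H. max_antichain A; \<nexists>R. common_refinement R H\<rbrakk> \<Longrightarrow> \<hh> \<le>o |H|"
proof -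
  let ?C = "{|H| | H :: pfin set set. (\<forall>A\<in>H. max_antichain A) \<and> (\<nexists>R. common_refinement R H)}"
  have "\<nexists>R. common_refinement R {A :: pfin set. max_antichain A}"
  proof
    assume "\<exists>R. common_refinement R {A :: pfin set. max_antichain A}"
    then obtain R :: "pfin set" where R: "max_antichain R"
      and ref: "\<And>A. max_antichain A \<Longrightarrow> refines R A"
      by (auto simp: common_refinement_def)
    have "R \<noteq> {}"
    proof
      assume "R = {}"
      moreover have "antichain {top :: pfin}"
        by (simp add: antichain_def) (transfer, simp)
      ultimately show False
        using R by (auto simp: max_antichain_def)
    qed
    then obtain x where x: "x \<in> R" "x \<noteq> bot"
      using R by (auto simp: max_antichain_def antichain_def)
    then obtain y where y: "y \<noteq> bot" "\<not> x \<le> y" "\<not> x \<le> - y"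
      by (metis pfin_split)
    have "- y \<noteq> bot"
      using y(2) by (metis compl_bot_eq double_compl top_greatest)
    have "max_antichain {y, - y}"
      unfolding max_antichain_def
    proof (intro conjI allI impI)
      show "antichain {y, - y}"
        using y(1) \<open>- y \<noteq> bot\<close> by (auto simp: antichain_def)
      fix B
      assume B: "antichain B" "{y, - y} \<subseteq> B"
      have "b \<in> {y, - y}" if "b \<in> B" for b
      proof (rule ccontr)
        assume "b \<notin> {y, - y}"
        then have "inf b y = bot" "inf b (- y) = bot"
          using B that by (auto simp: antichain_def)
        then have "b = bot"
          by (metis inf_sup_distrib1 inf_top_right sup_bot.right_neutral sup_compl_top)
        then show False
          using B that by (auto simp: antichain_def)
      qed
      with B show "B = {y, - y}"
        by blast
    qed
    then show False
      using ref x y by (force simp: refines_def)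
  qed
  then have "|{A :: pfin set. max_antichain A}| \<in> ?C"
    by blast
  then have ne: "?C \<noteq> {}"
    by blast
  have card: "\<forall>r\<in>?C. Card_order r"
    using card_of_Card_order by fast
  note * = least_card[OF ne card, folded cardinal_h_def]
  show "\<exists>H. (\<forall>A\<in>H. max_antichain A) \<and> (\<nexists>R. common_refinement R H) \<and> \<hh> = |H|"
    using *(1) by (elim CollectE exE conjE) (intro exI conjI)
  show "\<hh> \<le>o |H|" if "\<forall>A\<in>H. max_antichain A" "\<nexists>R. common_refinement R H"
    by (rule *(2)) (intro CollectI exI[of _ H] conjI refl that)
qed

end

theory Submission
  imports Defs "HOL-Library.Countable_Set"
begin

text \<open>If \<open>\<hh>\<close> is at least the continuum there is nothing to prove. Otherwise let \<open>H\<close> witness \<open>\<hh>\<close>. Some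
  \<open>x0\<close> has the property that every nonzero element below it is split by an antichain in \<open>H\<close>. There
  are maximal antichains \<open>\<R> C\<close>, indexed by \<open>C \<in> H\<close>, such that every countable subset of \<open>H\<close> is refined by
  one of them. Hence, for any countable family of nonzero elements below \<open>x0\<close>, some \<open>\<R> C\<close> has continuum
  many elements meeting each member of the family. By a Bernstein construction, \<open>\<R> C\<close> can be coloured
  with continuum many colours so that each element meeting continuum many members of \<open>\<R> C\<close> meets
  members of all colours.

  Transport the successor sets of a tree below \<open>x0\<close>. Given a tree \<open>p\<close> and a colour \<open>z\<close>, choose \<open>C\<close> for the
  countable family of its infinite successor sets and shrink each of them into a member of \<open>\<R> C\<close> of
  colour \<open>z\<close>. Compatible trees obtained in this way for the same \<open>C\<close> have the same colour, so the
  generic filter defines a partial function from \<open>H\<close> to the set of colours, and by density it is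
  onto.\<close>

section \<open>Maximal antichains in Boolean algebras\<close>

lemma max_antichain_meets:
  fixes A :: "'a::boolean_algebra set"
  assumes "max_antichain A" and "x \<noteq> bot"
  obtains a where "a \<in> A" "inf a x \<noteq> bot"
proof (cases "x \<in> A")
  case True
  then show ?thesis using assms(2) that[of x] by simp
next
  case False
  have "\<exists>a\<in>A. inf a x \<noteq> bot"
  proof (rule ccontr)
    assume *: "\<not> (\<exists>a\<in>A. inf a x \<noteq> bot)"
    then have "antichain (insert x A)"
      using assms by (auto simp: max_antichain_def antichain_def inf_commute)
    then have "insert x A = A"
      using assms(1) unfolding max_antichain_def by blast
    with False show False by blast
  qed
  then show ?thesis using that by blast
qed

lemma max_antichain_eqI:
  assumes "max_antichain A" "a \<in> A" "b \<in> A" "c \<le> a" "c \<le> b" "c \<noteq> bot"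
  shows "a = b"
proof (rule ccontr)
  assume "a \<noteq> b"
  then have "inf a b = bot"
    using assms by (auto simp: max_antichain_def antichain_def)
  then show False
    using assms by (metis le_inf_iff bot_unique)
qed

text \<open>Zorn's lemma gives an antichain maximal among those inside \<open>D\<close>. It is
  maximal outright: a new element of a larger antichain would have a nonzero \<open>y\<close> in
  \<open>D\<close> below it, and \<open>y\<close> could be added.\<close>

lemma max_antichain_within_dense:
  fixes D :: "'a::boolean_algebra set"
  assumes dense: "\<And>x. x \<noteq> bot \<Longrightarrow> \<exists>y\<in>D. y \<noteq> bot \<and> y \<le> x"
  shows "\<exists>R. max_antichain R \<and> R \<subseteq> D"
proof -
  let ?Z = "{R. antichain R \<and> R \<subseteq> D}"
  have "\<exists>M\<in>?Z. \<forall>X\<in>?Z. M \<subseteq> X \<longrightarrow> X = M"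
  proof (rule subset_Zorn')
    fix \<C> assume C: "subset.chain ?Z \<C>"
    have "antichain (\<Union>\<C>)"
      unfolding antichain_def
    proof (intro conjI ballI impI)
      show "bot \<notin> \<Union>\<C>"
        using C by (auto simp: subset_chain_def antichain_def)
      fix a b assume "a \<in> \<Union>\<C>" "b \<in> \<Union>\<C>" "a \<noteq> b"
      then obtain X Y where "X \<in> \<C>" "Y \<in> \<C>" "a \<in> X" "b \<in> Y"
        by blast
      moreover from this have "X \<subseteq> Y \<or> Y \<subseteq> X"
        using C by (auto simp: subset_chain_def)
      ultimately obtain Z where "Z \<in> \<C>" "a \<in> Z" "b \<in> Z"
        by blast
      then show "inf a b = bot"
        using C \<open>a \<noteq> b\<close> by (auto simp: subset_chain_def antichain_def)
    qed
    then show "\<Union>\<C> \<in> ?Z"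
      using C by (auto simp: subset_chain_def)
  qed
  then obtain M where M: "antichain M" "M \<subseteq> D"
    and max: "\<And>X. antichain X \<Longrightarrow> X \<subseteq> D \<Longrightarrow> M \<subseteq> X \<Longrightarrow> X = M"
    by auto
  have "B = M" if B: "antichain B" "M \<subseteq> B" for B
  proof (rule ccontr)
    assume "B \<noteq> M"
    then obtain b where b: "b \<in> B" "b \<notin> M"
      using B by blast
    then have "b \<noteq> bot"
      using B by (auto simp: antichain_def)
    then obtain y where y: "y \<in> D" "y \<noteq> bot" "y \<le> b"
      using dense by blast
    have disj: "inf a y = bot" if "a \<in> M" for a
    proof -
      have "inf a b = bot"
        using B b that by (auto simp: antichain_def)
      then show ?thesis
        using y(3) by (metis bot_unique inf_mono order_refl)
    qed
    then have "antichain (insert y M)"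
      using M(1) y(2) by (auto simp: antichain_def inf_commute)
    then have "y \<in> M"
      using max[of "insert y M"] M(2) y(1) by blast
    then show False
      using disj[of y] y(2) by simp
  qed
  then show ?thesis
    using M by (auto simp: max_antichain_def)
qed

section \<open>Decreasing sequences in P(omega)/fin\<close>

lemma abs_pfin_le_iff: "abs_pfin A \<le> abs_pfin B \<longleftrightarrow> finite (A - B)"
  by (rule less_eq_pfin.abs_eq)

lemma abs_pfin_mono:
  assumes "A \<subseteq> B"
  shows "abs_pfin A \<le> abs_pfin B"
  using assms unfolding abs_pfin_le_iff by (metis Diff_eq_empty_iff finite.emptyI)

lemma abs_pfin_eq_bot_iff: "abs_pfin A = bot \<longleftrightarrow> finite A"
  by (simp add: bot_pfin_def pfin.abs_eq_iff)

lemma abs_rep_pfin: "abs_pfin (rep_pfin x) = x"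
  by (rule Quotient3_abs_rep[OF Quotient3_pfin])

text \<open>Diagonalization: an infinite set whose point \<open>k n\<close> lies in the first
  \<open>n + 1\<close> representatives is almost contained in each of them.\<close>

lemma pfin_decseq_lower_bound:
  fixes y :: "nat \<Rightarrow> pfin"
  assumes dec: "\<And>n. y (Suc n) \<le> y n" and ne: "\<And>n. y n \<noteq> bot"
  shows "\<exists>z. z \<noteq> bot \<and> (\<forall>n. z \<le> y n)"
proof -
  define Y where "Y n = rep_pfin (y n)" for n
  have y: "y n = abs_pfin (Y n)" for n
    by (simp add: Y_def abs_rep_pfin)
  have infY: "infinite (Y n)" for n
    using ne[of n] by (simp add: y abs_pfin_eq_bot_iff)
  have anti: "finite (Y n - Y m)" if "m \<le> n" for m n
  proof -
    have "y n \<le> y m"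
      using lift_Suc_antimono_le[of y] dec that by blast
    then show ?thesis by (simp add: y abs_pfin_le_iff)
  qed
  \<comment> \<open>The representatives decrease only modulo finite sets, but \<open>Y n\<close>
    loses just finitely many points to each earlier \<open>Y i\<close>.\<close>
  have inf: "infinite (\<Inter>i\<le>n. Y i)" for n
  proof
    assume "finite (\<Inter>i\<le>n. Y i)"
    moreover have "finite (\<Union>i\<in>{..n}. Y n - Y i)"
      using anti by (intro finite_UN_I) auto
    moreover have "Y n \<subseteq> (\<Inter>i\<le>n. Y i) \<union> (\<Union>i\<le>n. Y n - Y i)"
      by blast
    ultimately show False
      using infY[of n] by (meson finite_UnI finite_subset)
  qed
  have "\<exists>k. \<forall>n. k n \<in> (\<Inter>i\<le>n. Y i) \<and> k n < k (Suc n)"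
  proof (rule dependent_nat_choice)
    show "\<exists>k. k \<in> (\<Inter>i\<le>0. Y i)"
      using infinite_imp_nonempty[OF inf[of 0]] by blast
    show "\<exists>k'. k' \<in> (\<Inter>i\<le>Suc n. Y i) \<and> k < k'" for k n
      using inf[of "Suc n"] by (metis infinite_nat_iff_unbounded)
  qed
  then obtain k where k: "\<And>n. k n \<in> (\<Inter>i\<le>n. Y i)" and mono: "\<And>n. k n < k (Suc n)"
    by blast
  have "inj k"
    using mono by (intro strict_mono_imp_inj_on) (simp add: strict_mono_Suc_iff)
  then have "abs_pfin (range k) \<noteq> bot"
    by (simp add: abs_pfin_eq_bot_iff range_inj_infinite)
  moreover have "abs_pfin (range k) \<le> y n" for n
  proof -
    have "k m \<in> Y n" if "\<not> m < n" for m
      using k[of m] that by simp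
    then have "range k - Y n \<subseteq> k ` {..<n}"
      by blast
    then show ?thesis
      unfolding y abs_pfin_le_iff by (rule finite_subset) simp
  qed
  ultimately show ?thesis by blast
qed

section \<open>Common refinements and splitting\<close>

lemma common_refinement_if_dense:
  fixes H :: "'a::boolean_algebra set set"
  assumes "\<And>x. x \<noteq> bot \<Longrightarrow> \<exists>y. y \<noteq> bot \<and> y \<le> x \<and> (\<forall>A\<in>H. \<exists>a\<in>A. y \<le> a)"
  shows "\<exists>R. common_refinement R H"
proof -
  have "\<exists>R. max_antichain R \<and> R \<subseteq> {y. \<forall>A\<in>H. \<exists>a\<in>A. y \<le> a}"
    by (rule max_antichain_within_dense) (use assms in blast)
  then show ?thesis
    by (auto simp: common_refinement_def refines_def)
qed

text \<open>Density comes from lower bounds of sequences: shrink \<open>x\<close> below a member of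
  each antichain in turn and take a lower bound.\<close>

lemma countable_common_refinement:
  fixes H :: "pfin set set"
  assumes "countable H" and max: "\<And>A. A \<in> H \<Longrightarrow> max_antichain A"
  shows "\<exists>R. common_refinement R H"
proof (rule common_refinement_if_dense)
  fix x :: pfin assume x: "x \<noteq> bot"
  show "\<exists>y. y \<noteq> bot \<and> y \<le> x \<and> (\<forall>A\<in>H. \<exists>a\<in>A. y \<le> a)"
  proof (cases "H = {}")
    case True
    then show ?thesis using x by blast
  next
    case False
    define A where "A = from_nat_into H"
    have A: "range A = H"
      unfolding A_def using False assms(1) by (rule range_from_nat_into)
    have step: "\<exists>z. (z \<noteq> bot \<and> z \<le> x) \<and> z \<le> y \<and> (\<exists>a\<in>A n. z \<le> a)"
      if y: "y \<noteq> bot \<and> y \<le> x" for y n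
    proof -
      have "max_antichain (A n)"
        using max A by blast
      then obtain a where "a \<in> A n" "inf a y \<noteq> bot"
        using y max_antichain_meets by metis
      then show ?thesis
        using y by (intro exI[of _ "inf a y"]) (auto intro: le_infI2 bexI[of _ a])
    qed
    have "\<exists>y. \<forall>n. (y n \<noteq> bot \<and> y n \<le> x) \<and> (y (Suc n) \<le> y n \<and> (\<exists>a\<in>A n. y (Suc n) \<le> a))"
      by (rule dependent_nat_choice) (use x in blast, rule step)
    then obtain y where y: "\<And>n. y n \<noteq> bot \<and> y n \<le> x"
        "\<And>n. y (Suc n) \<le> y n \<and> (\<exists>a\<in>A n. y (Suc n) \<le> a)"
      by blast
    obtain z where z: "z \<noteq> bot" "\<And>n. z \<le> y n"
      using pfin_decseq_lower_bound y by blast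
    have "\<exists>a\<in>A n. z \<le> a" for n
      using y(2)[of n] z(2)[of "Suc n"] by (meson order_trans)
    moreover have "z \<le> x"
      using y(1)[of 0] z(2)[of 0] by (meson order_trans)
    ultimately show ?thesis
      using z(1) A by blast
  qed
qed

text \<open>\<open>x0\<close> witnesses the failure of density. If \<open>y\<close> is below no
  member of \<open>A\<close>, it meets some \<open>a\<close>, and what remains of \<open>y\<close>
  outside \<open>a\<close> meets another member.\<close>

lemma no_common_refinement_splits:
  fixes H :: "'a::boolean_algebra set set"
  assumes "\<forall>A\<in>H. max_antichain A" and "\<nexists>R. common_refinement R H"
  obtains x0 where "x0 \<noteq> bot"
    and "\<And>y. y \<noteq> bot \<Longrightarrow> y \<le> x0 \<Longrightarrow>
      \<exists>A\<in>H. \<exists>a\<in>A. \<exists>b\<in>A. a \<noteq> b \<and> inf a y \<noteq> bot \<and> inf b y \<noteq> bot"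
proof -
  obtain x0 where x0: "x0 \<noteq> bot"
    and no: "\<And>y. y \<noteq> bot \<Longrightarrow> y \<le> x0 \<Longrightarrow> \<exists>A\<in>H. \<forall>a\<in>A. \<not> y \<le> a"
    using assms(2) by (metis common_refinement_if_dense)
  have "\<exists>A\<in>H. \<exists>a\<in>A. \<exists>b\<in>A. a \<noteq> b \<and> inf a y \<noteq> bot \<and> inf b y \<noteq> bot"
    if y: "y \<noteq> bot" "y \<le> x0" for y
  proof -
    obtain A where A: "A \<in> H" "\<And>a. a \<in> A \<Longrightarrow> \<not> y \<le> a"
      using no y by blast
    have max: "max_antichain A" using A assms by blast
    obtain a where a: "a \<in> A" "inf a y \<noteq> bot"
      using max_antichain_meets[OF max y(1)] by blast
    have "inf y (- a) \<noteq> bot"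
      using A(2)[OF a(1)] by (metis double_compl inf_shunt)
    then obtain b where b: "b \<in> A" "inf b (inf y (- a)) \<noteq> bot"
      using max_antichain_meets[OF max] by blast
    have "a \<noteq> b"
    proof
      assume "a = b"
      then have "inf b (inf y (- a)) \<le> inf a (- a)" by (simp add: le_infI2)
      with b(2) show False by (simp add: bot_unique)
    qed
    moreover have "inf b y \<noteq> bot"
      using b(2) by (metis inf_assoc inf_bot_left)
    ultimately show ?thesis using A(1) a b(1) by blast
  qed
  with x0 that show ?thesis by blast
qed

text \<open>A binary tree of successive splittings below \<open>x\<close> has continuum many branches. Each branch has
  a lower bound, and lower bounds of different branches meet different elements of any refinement of
  the countably many antichains used.\<close>

lemma countable_splitting_family:
  fixes H :: "pfin set set"
  assumes max: "\<forall>A\<in>H. max_antichain A"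
    and split: "\<And>y. y \<noteq> bot \<Longrightarrow> y \<le> x0 \<Longrightarrow>
      \<exists>A\<in>H. \<exists>a\<in>A. \<exists>b\<in>A. a \<noteq> b \<and> inf a y \<noteq> bot \<and> inf b y \<noteq> bot"
    and x: "x \<noteq> bot" "x \<le> x0"
  shows "\<exists>T\<subseteq>H. countable T \<and>
    (\<forall>R. common_refinement R T \<longrightarrow> |UNIV :: nat set set| \<le>o |{e\<in>R. inf e x \<noteq> bot}| )"
proof -
  have "\<exists>A a b. A \<in> H \<and> a \<in> A \<and> b \<in> A \<and> a \<noteq> b \<and> inf a y \<noteq> bot \<and> inf b y \<noteq> bot"
    if "y \<noteq> bot" "y \<le> x0" for y
    using split[OF that] by blast
  then obtain \<A> \<a> \<b> where AB: "\<And>y. y \<noteq> bot \<Longrightarrow> y \<le> x0 \<Longrightarrow>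
      \<A> y \<in> H \<and> \<a> y \<in> \<A> y \<and> \<b> y \<in> \<A> y \<and> \<a> y \<noteq> \<b> y \<and> inf (\<a> y) y \<noteq> bot \<and> inf (\<b> y) y \<noteq> bot"
    by metis
  define c where "c y i = (if i then \<a> y else \<b> y)" for y i
  have cA: "c y i \<in> \<A> y" and cne: "inf (c y i) y \<noteq> bot" if "y \<noteq> bot" "y \<le> x0" for y i
    using AB[OF that] by (auto simp: c_def)
  have cinj: "c y i \<noteq> c y j" if "y \<noteq> bot" "y \<le> x0" "i \<noteq> j" for y i j
    using AB[OF that(1,2)] that(3) by (auto simp: c_def)
  \<comment> \<open>\<open>Y s\<close> is the node reached from \<open>x\<close> along the path
    \<open>s\<close>, each boolean choosing one of the two elements that split the current
    node.\<close>
  define Y where "Y s = foldl (\<lambda>y i. inf (c y i) y) x s" for s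
  have Y0: "Y [] = x" and YS: "Y (s @ [i]) = inf (c (Y s) i) (Y s)" for s i
    by (simp_all add: Y_def)
  have Y: "Y s \<noteq> bot \<and> Y s \<le> x0" for s
    by (induction s rule: rev_induct) (use x cne in \<open>auto simp: Y0 YS intro: le_infI2\<close>)
  define T where "T = range (\<lambda>s. \<A> (Y s))"
  have "T \<subseteq> H" using AB Y by (auto simp: T_def)
  moreover have "countable T" by (simp add: T_def)
  moreover have "|UNIV :: nat set set| \<le>o |{e\<in>R. inf e x \<noteq> bot}|"
    if R: "common_refinement R T" for R
  proof -
    \<comment> \<open>\<open>B U n\<close> is the characteristic sequence of \<open>U\<close> below
      \<open>n\<close>, so \<open>U\<close> determines a branch.\<close>
    define B where "B U n = map (\<lambda>i. i \<in> U) [0..<n]" for U :: "nat set" and n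
    have B0: "B U 0 = []" and BS: "B U (Suc n) = B U n @ [n \<in> U]" for U n
      by (simp_all add: B_def)
    have "\<exists>e\<in>R. \<forall>n. inf e (Y (B U n)) \<noteq> bot" for U
    proof -
      obtain z where z: "z \<noteq> bot" "\<And>n. z \<le> Y (B U n)"
        using pfin_decseq_lower_bound[of "\<lambda>n. Y (B U n)"] Y by (auto simp: BS YS)
      obtain e where e: "e \<in> R" "inf e z \<noteq> bot"
        using R z(1) max_antichain_meets unfolding common_refinement_def by metis
      then show ?thesis
        using z(2) by (metis bot_unique inf_mono order_refl)
    qed
    then obtain e where e: "\<And>U. e U \<in> R" "\<And>U n. inf (e U) (Y (B U n)) \<noteq> bot"
      by metis
    \<comment> \<open>\<open>e U\<close> lies below some member of the antichain splitting
      \<open>?y\<close> and meets the next node of the branch, so this member is the one the branch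
      followed.\<close>
    have below: "e U \<le> c (Y (B U n)) (n \<in> U)" for U n
    proof -
      let ?y = "Y (B U n)"
      have "\<A> ?y \<in> T" by (simp add: T_def)
      then obtain a where a: "a \<in> \<A> ?y" "e U \<le> a"
        using R e(1) unfolding common_refinement_def refines_def by blast
      have "inf (e U) (inf (c ?y (n \<in> U)) ?y) \<noteq> bot"
        using e(2)[of U "Suc n"] by (simp add: BS YS)
      then have "a = c ?y (n \<in> U)"
        using a cA Y max AB
        by (intro max_antichain_eqI[where A = "\<A> ?y" and c = "inf (e U) (inf (c ?y (n \<in> U)) ?y)"])
          (auto intro: le_infI1 le_infI2)
      with a(2) show ?thesis by simp
    qed
    have "inj e"
    proof (rule injI, rule ccontr)
      fix U V assume eq: "e U = e V" and "U \<noteq> V"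
      \<comment> \<open>At the first difference the branches leave the same node in different
        directions, so the common value would lie below two members of one antichain.\<close>
      define n where "n = (LEAST n. (n \<in> U) \<noteq> (n \<in> V))"
      have ex: "\<exists>n. (n \<in> U) \<noteq> (n \<in> V)" using \<open>U \<noteq> V\<close> by blast
      have n: "(n \<in> U) \<noteq> (n \<in> V)" unfolding n_def by (rule LeastI_ex[OF ex])
      have "(m \<in> U) = (m \<in> V)" if "m < n" for m
        using not_less_Least[of m "\<lambda>n. (n \<in> U) \<noteq> (n \<in> V)"] that unfolding n_def by blast
      then have "B U n = B V n" by (simp add: B_def)
      then have "e U \<le> c (Y (B U n)) (n \<in> U)" "e U \<le> c (Y (B U n)) (n \<in> V)"
        using below[of U n] below[of V n] eq by simp_all
      moreover have "e U \<noteq> bot" using e(2)[of U 0] by auto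
      moreover have "max_antichain (\<A> (Y (B U n)))" using AB Y max by blast
      ultimately show False
        using max_antichain_eqI cA Y cinj n by metis
    qed
    moreover have "range e \<subseteq> {e\<in>R. inf e x \<noteq> bot}"
      using e(1) e(2)[of _ 0] by (auto simp: B0 Y0)
    ultimately show ?thesis
      using card_of_ordLeq by blast
  qed
  ultimately show ?thesis by blast
qed

section \<open>Bernstein colourings\<close>

text \<open>Recursion along a cardinal order of \<open>J \<times> UNIV\<close> picks distinct points
  \<open>h (j, c)\<close> in \<open>S j\<close>: at each stage fewer points have been used than
  \<open>S j\<close> has. The point \<open>h (j, c)\<close> then gets colour
  \<open>c\<close>.\<close>

lemma surjective_colouring:
  fixes S :: "'j \<Rightarrow> 'a set"
  assumes inf: "infinite (UNIV :: 'c set)" and J: "|J| \<le>o |UNIV :: 'c set|"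
    and S: "\<And>j. j \<in> J \<Longrightarrow> |UNIV :: 'c set| \<le>o |S j|"
  shows "\<exists>g :: 'a \<Rightarrow> 'c. \<forall>j\<in>J. g ` S j = UNIV"
proof -
  let ?K = "J \<times> (UNIV :: 'c set)"
  let ?r = "|?K|"
  have K: "?r \<le>o |UNIV :: 'c set|"
    using inf J card_of_refl ordIso_imp_ordLeq card_of_Card_order
    by (intro card_of_Times_ordLeq_infinite_Field) (simp_all only: Field_card_of, blast+)
  have wo: "Well_order ?r" and F: "Field ?r = ?K"
    by (rule card_of_Well_order, rule Field_card_of)
  have wf: "wf (?r - Id)"
    using wo by (simp add: well_order_on_def)
  \<comment> \<open>The requirement is vacuous outside \<open>?K\<close>, so the recursion can run
    over the whole index type.\<close>
  define Q where "Q h k y \<longleftrightarrow> (k \<in> ?K \<longrightarrow> y \<in> S (fst k) \<and> y \<notin> h ` underS ?r k)" for h k y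
  have "\<exists>h. \<forall>k. Q h k (h k)"
  proof (rule dependent_wf_choice[OF wf])
    fix h g :: "'j \<times> 'c \<Rightarrow> 'a" and k y assume "\<And>z. (z, k) \<in> ?r - Id \<Longrightarrow> h z = g z"
    then have "h ` underS ?r k = g ` underS ?r k"
      by (intro image_cong) (auto simp: underS_def)
    then show "Q h k y = Q g k y" by (simp add: Q_def)
  next
    fix k and h :: "'j \<times> 'c \<Rightarrow> 'a"
    show "\<exists>y. Q h k y"
    proof (cases "k \<in> ?K")
      case True
      have "|underS ?r k| <o ?r"
        by (rule card_of_underS[OF card_of_Card_order]) (use True F in metis)
      then have "|h ` underS ?r k| <o |UNIV :: 'c set|"
        using K ordLeq_ordLess_trans[OF card_of_image] ordLess_ordLeq_trans by metis
      moreover have "|UNIV :: 'c set| \<le>o |S (fst k)|"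
        using True by (intro S) auto
      ultimately have "|h ` underS ?r k| <o |S (fst k)|"
        by (rule ordLess_ordLeq_trans)
      then have "\<not> S (fst k) \<subseteq> h ` underS ?r k"
        using card_of_mono1 not_ordLess_ordLeq by metis
      then show ?thesis by (auto simp: Q_def)
    qed (simp add: Q_def)
  qed
  then obtain h where h: "\<And>k. k \<in> ?K \<Longrightarrow> h k \<in> S (fst k)"
      "\<And>k. k \<in> ?K \<Longrightarrow> h k \<notin> h ` underS ?r k"
    unfolding Q_def by blast
  have "inj_on h ?K"
  proof (rule inj_onI, rule ccontr)
    fix k l assume kl: "k \<in> ?K" "l \<in> ?K" "h k = h l" "k \<noteq> l"
    then have "(k, l) \<in> ?r \<or> (l, k) \<in> ?r"
      using wo_rel.TOTALS[OF wo_rel.intro[OF wo]] unfolding F by blast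
    then have "k \<in> underS ?r l \<or> l \<in> underS ?r k"
      using kl(4) unfolding underS_def by blast
    then show False
      using h(2) kl by (metis image_eqI)
  qed
  then have inv: "inv_into ?K h (h k) = k" if "k \<in> ?K" for k
    using that by simp
  have "(snd \<circ> inv_into ?K h) ` S j = UNIV" if "j \<in> J" for j
  proof -
    have "c \<in> (snd \<circ> inv_into ?K h) ` S j" for c
      using inv[of "(j, c)"] h(1)[of "(j, c)"] that by (intro image_eqI[of _ _ "h (j, c)"]) auto
    then show ?thesis by blast
  qed
  then show ?thesis by blast
qed

text \<open>Choosing representatives embeds \<open>pfin\<close> into the sets of naturals, so at
  most continuum many elements \<open>x\<close> have to be served.\<close>

lemma pfin_surjective_colouring:
  fixes R :: "pfin set"
  shows "\<exists>g :: pfin \<Rightarrow> nat set. \<forall>x. |UNIV :: nat set set| \<le>o |{e\<in>R. inf e x \<noteq> bot}| \<longrightarrow>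
    (\<forall>z. \<exists>e\<in>R. inf e x \<noteq> bot \<and> g e = z)"
proof -
  let ?J = "{x. |UNIV :: nat set set| \<le>o |{e\<in>R. inf e x \<noteq> bot}|}"
  have "inj rep_pfin"
    by (metis abs_rep_pfin injI)
  then have "|?J| \<le>o |UNIV :: nat set set|"
    using card_of_ordLeqI[of rep_pfin ?J UNIV] by (auto intro: inj_on_subset)
  moreover have "infinite (UNIV :: nat set set)"
    by (simp add: Finite_Set.finite_set)
  ultimately have "\<exists>g :: pfin \<Rightarrow> nat set. \<forall>x\<in>?J. g ` {e\<in>R. inf e x \<noteq> bot} = UNIV"
    by (intro surjective_colouring) auto
  then obtain g :: "pfin \<Rightarrow> nat set" where g: "\<forall>x\<in>?J. g ` {e\<in>R. inf e x \<noteq> bot} = UNIV"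
    by (rule exE)
  have "\<exists>e\<in>R. inf e x \<noteq> bot \<and> g e = z" if "x \<in> ?J" for x z
  proof -
    have "z \<in> g ` {e\<in>R. inf e x \<noteq> bot}" using bspec[OF g that] by simp
    then show ?thesis by blast
  qed
  then show ?thesis by (intro exI[of _ g]) simp
qed

section \<open>Refining countable parts of a witness for \<open>\<hh>\<close>\<close>

text \<open>Initial segments of a well-order of type \<open>\<hh>\<close> of \<open>H\<close> have common refinements. A countable
  cofinal set would turn these into countably many antichains whose common refinement refines all
  of \<open>H\<close>.\<close>

lemma countably_directed_refinements:
  fixes H :: "pfin set set"
  assumes max: "\<forall>A\<in>H. max_antichain A" and no: "\<nexists>R. common_refinement R H" and h: "\<hh> = |H|"
  obtains \<R> where "\<And>C. C \<in> H \<Longrightarrow> max_antichain (\<R> C)"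
    and "\<And>T. T \<subseteq> H \<Longrightarrow> countable T \<Longrightarrow> \<exists>C\<in>H. common_refinement (\<R> C) T"
proof -
  let ?r = "|H|"
  have wo: "Well_order ?r" and F: "Field ?r = H"
    by (rule card_of_Well_order, rule Field_card_of)
  have "\<exists>R. common_refinement R (insert C (underS ?r C))" if "C \<in> H" for C
  proof -
    have sub: "underS ?r C \<subseteq> H"
      using F by (auto simp: underS_def Field_def)
    \<comment> \<open>A proper initial segment of the order has fewer than \<open>\<hh>\<close>
      members, so by minimality of \<open>\<hh>\<close> it has a common refinement.\<close>
    have "|underS ?r C| <o ?r"
      by (rule card_of_underS[OF card_of_Card_order]) (use that F in metis)
    then have "\<exists>R. common_refinement R (underS ?r C)"
      using cardinal_h_welldefined(2)[of "underS ?r C"] sub max h not_ordLess_ordLeq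
      by (metis subsetD)
    then obtain R1 where R1: "common_refinement R1 (underS ?r C)" by blast
    then have "\<exists>R. common_refinement R {R1, C}"
      using max that by (intro countable_common_refinement) (auto simp: common_refinement_def)
    then obtain R where "common_refinement R {R1, C}" by blast
    then have "common_refinement R (insert C (underS ?r C))"
      using R1 unfolding common_refinement_def refines_def
      by (metis (no_types, lifting) insert_iff order_trans)
    then show ?thesis by blast
  qed
  then obtain \<R> where R: "\<And>C. C \<in> H \<Longrightarrow> common_refinement (\<R> C) (insert C (underS ?r C))"
    by metis
  have "\<exists>C\<in>H. common_refinement (\<R> C) T" if T: "T \<subseteq> H" "countable T" for T
  proof (rule ccontr)
    assume neg: "\<not> (\<exists>C\<in>H. common_refinement (\<R> C) T)"
    \<comment> \<open>As \<open>\<R> C\<close> refines every antichain up to \<open>C\<close>, a set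
      \<open>T\<close> refined by no \<open>\<R> C\<close> is bounded by no \<open>C\<close>, hence
      cofinal.\<close>
    have cof: "\<exists>A\<in>T. C \<in> insert A (underS ?r A)" if C: "C \<in> H" for C
    proof -
      have "\<not> T \<subseteq> insert C (underS ?r C)"
        using neg C R[OF C] unfolding common_refinement_def by (meson subsetD)
      then obtain A where A: "A \<in> T" "A \<noteq> C" "(A, C) \<notin> ?r"
        unfolding underS_def by blast
      then have "(C, A) \<in> ?r"
        using wo_rel.TOTALS[OF wo_rel.intro[OF wo]] T C unfolding F by blast
      then show ?thesis
        using A unfolding underS_def by blast
    qed
    have "\<exists>R. common_refinement R (\<R> ` T)"
      using T R by (intro countable_common_refinement) (auto simp: common_refinement_def)
    then obtain S where S: "common_refinement S (\<R> ` T)" by blast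
    have "refines S C" if C: "C \<in> H" for C
    proof -
      obtain A where A: "A \<in> T" "C \<in> insert A (underS ?r A)" using cof C by blast
      then have "refines S (\<R> A)" "refines (\<R> A) C"
        using S R[of A] T(1) unfolding common_refinement_def by auto
      then show ?thesis unfolding refines_def by (meson order_trans)
    qed
    then have "common_refinement S H"
      using S unfolding common_refinement_def by blast
    with no show False by blast
  qed
  moreover have "max_antichain (\<R> C)" if "C \<in> H" for C
    using R[OF that] unfolding common_refinement_def by blast
  ultimately show ?thesis by (rule that[rotated])
qed

section \<open>Names for surjections\<close>

text \<open>\<open>V a b q\<close> says that \<open>q\<close> decides the value of the new surjection at \<open>a\<close> to be \<open>b\<close>. The name is
  made total by giving it the default value \<open>b0\<close> wherever no extension of a condition decides.\<close>

lemma collapses_if_decided: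
  fixes r :: "'a rel" and c :: "'b rel"
  assumes refl: "\<And>p. p \<in> P \<Longrightarrow> le p p" and trans: "\<And>p q r. le p q \<Longrightarrow> le q r \<Longrightarrow> le p r"
    and b0: "b0 \<in> Field c"
    and down: "\<And>a b p q. V a b q \<Longrightarrow> le p q \<Longrightarrow> V a b p"
    and cons: "\<And>a b b' p. a \<in> Field r \<Longrightarrow> p \<in> P \<Longrightarrow> V a b p \<Longrightarrow> V a b' p \<Longrightarrow> b = b'"
    and onto: "\<And>p b. p \<in> P \<Longrightarrow> b \<in> Field c \<Longrightarrow> \<exists>a\<in>Field r. \<exists>q\<in>P. le q p \<and> V a b q"
  shows "collapses P le c r"
proof -
  define W where "W a b q \<longleftrightarrow> V a b q \<or> b = b0 \<and> (\<forall>p\<in>P. le p q \<longrightarrow> (\<forall>b\<in>Field c. \<not> V a b p))"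
    for a b q
  let ?f = "{((a, b), p) | a b p. a \<in> Field r \<and> b \<in> Field c \<and> p \<in> P \<and> W a b p}"
  have Wdown: "W a b p" if "W a b q" "le p q" for a b p q
    using that down trans unfolding W_def by blast
  \<comment> \<open>A condition deciding a value in \<open>Field c\<close> extends itself, so the
    default clause fails for it.\<close>
  have Wcons: "b = b'" if "a \<in> Field r" "b \<in> Field c" "b' \<in> Field c" "p \<in> P" "W a b p" "W a b' p"
    for a b b' p
    using that cons refl unfolding W_def by blast
  have Wtotal: "\<exists>q\<in>P. le q p \<and> (\<exists>b\<in>Field c. W a b q)" if "p \<in> P" for a p
    using that b0 refl unfolding W_def by blast
  have allI': "\<And>p. p \<in> P \<Longrightarrow> fall P le X \<phi> p" if "\<And>x p. x \<in> X \<Longrightarrow> p \<in> P \<Longrightarrow> \<phi> x p"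
    for X :: "'x set" and \<phi>
    unfolding fall_def fex_def dense_below_def fnot_def using that refl by meson
  have impI': "\<And>p. p \<in> P \<Longrightarrow> fimp P le \<phi> \<psi> p" if "\<And>p. p \<in> P \<Longrightarrow> \<phi> p \<Longrightarrow> \<psi> p" for \<phi> \<psi>
    unfolding fimp_def fand_def fnot_def using that refl by meson
  have memI: "fmem P le (a, b) ?f p" if "p \<in> P" "a \<in> Field r" "b \<in> Field c" "W a b p" for a b p
    using that refl Wdown unfolding fmem_def dense_below_def by blast
  have memD: "\<exists>q\<in>P. le q p \<and> W a b q" if "p \<in> P" "fmem P le (a, b) ?f p" for a b p
    using that refl Wdown unfolding fmem_def dense_below_def by blast
  have fmem_down: "fmem P le ab \<tau> q" if "fmem P le ab \<tau> p" "le q p" for ab \<tau> p q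
    using that trans unfolding fmem_def dense_below_def by blast
  have total: "fex P le (Field c) (\<lambda>b. fmem P le (a, b) ?f) p" if "p \<in> P" "a \<in> Field r" for a p
    unfolding fex_def dense_below_def using Wtotal memI that by meson
  have surj: "fex P le (Field r) (\<lambda>a. fmem P le (a, b) ?f) p" if "p \<in> P" "b \<in> Field c" for b p
    unfolding fex_def dense_below_def
  proof (intro ballI impI)
    fix q assume "q \<in> P"
    then obtain a s where "a \<in> Field r" "s \<in> P" "le s q" "V a b s" using onto \<open>b \<in> Field c\<close> by blast
    then show "\<exists>s\<in>P. le s q \<and> (\<exists>a\<in>Field r. fmem P le (a, b) ?f s)"
      using memI[of s a b] \<open>b \<in> Field c\<close> by (auto simp: W_def)
  qed
  \<comment> \<open>Forced membership gives \<open>W\<close> only at some extension; two successive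
    extensions bring both values to one condition \<open>s\<close>.\<close>
  have unique: "b = b'"
    if a: "a \<in> Field r" "b \<in> Field c" "b' \<in> Field c" "p \<in> P"
      and m: "fmem P le (a, b) ?f p" "fmem P le (a, b') ?f p" for a b b' p
  proof -
    obtain q where q: "q \<in> P" "le q p" "W a b q" using memD[OF a(4) m(1)] by blast
    then obtain s where s: "s \<in> P" "le s q" "W a b' s" 
      using memD[OF q(1) fmem_down[OF m(2) q(2)]] by blast
    show ?thesis using Wcons[OF a(1-3) s(1) Wdown[OF q(3) s(2)] s(3)] .
  qed
  have "fsurjection P le (Field r) (Field c) ?f p" if "p \<in> P" for p
    unfolding fsurjection_def ffunction_def fand_def
    by (intro conjI allI' impI' that total surj; (unfold feq_def)?; (elim conjE, rule unique)?) assumption+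
  moreover have "?f \<in> names P (Field r \<times> Field c)"
    by (auto simp: names_def)
  ultimately show ?thesis
    unfolding collapses_def forced_def fex_def dense_below_def using refl by blast
qed

section \<open>Thinning trees\<close>

lemma Succ_mono: "p \<subseteq> q \<Longrightarrow> Succ p s \<subseteq> Succ q s"
  by (auto simp: Succ_def)

text \<open>Successors are cut down only at infinitely splitting nodes, so nothing is lost below the
  stem or along segments that split finitely.\<close>

definition thin :: "nat list set \<Rightarrow> (nat list \<Rightarrow> nat set) \<Rightarrow> nat list set" where
  "thin p B = {t\<in>p. \<forall>u n. prefix (u @ [n]) t \<longrightarrow> infinite (Succ p u) \<longrightarrow> n \<in> B u}"

lemma thin_subset: "thin p B \<subseteq> p"
  by (auto simp: thin_def)

lemma tree_thin:
  assumes "tree p"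
  shows "tree (thin p B)"
proof -
  have "[] \<in> p" using assms by (auto simp: tree_def)
  then have "[] \<in> thin p B" by (simp add: thin_def)
  moreover have "s \<in> thin p B" if "t \<in> thin p B" "prefix s t" for s t
    using that assms unfolding thin_def tree_def by (auto dest: prefix_order.trans)
  ultimately show ?thesis unfolding tree_def by blast
qed

lemma Succ_thin_subset:
  assumes "infinite (Succ p s)"
  shows "Succ (thin p B) s \<subseteq> B s"
  using assms by (auto simp: Succ_def thin_def)

lemma Succ_thin:
  assumes "infinite (Succ p s)" "B s \<subseteq> Succ p s" "s \<in> thin p B"
  shows "Succ (thin p B) s = B s"
proof
  show "B s \<subseteq> Succ (thin p B) s"
    using assms by (auto simp: Succ_def thin_def)
qed (rule Succ_thin_subset[OF assms(1)])

text \<open>A comparable node longer than \<open>t\<close> would extend \<open>t @ [n]\<close> for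
  infinitely many \<open>n\<close>, so there is a longest comparable node. Comparable nodes form a
  chain, so it is the stem.\<close>

lemma is_stem_exists:
  assumes "tree p" "t \<in> p" "infinite (Succ p t)"
  obtains s where "is_stem p s" "\<And>u. comparable_node p u \<Longrightarrow> prefix u s"
proof -
  have bounded: "length u \<le> length t" if u: "comparable_node p u" for u
  proof (rule ccontr)
    assume "\<not> length u \<le> length t"
    then have "prefix (t @ [n]) u" if "n \<in> Succ p t" for n
      using u that unfolding comparable_node_def Succ_def
      by (metis length_append_singleton mem_Collect_eq not_less_eq_eq prefix_length_prefix
          prefix_order.eq_iff prefix_length_le Suc_leI not_le)
    then have "n = u ! length t" if "n \<in> Succ p t" for n
      using that by (force simp: prefix_def)
    then have "Succ p t \<subseteq> {u ! length t}" by blast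
    then show False using assms(3) finite_subset by blast
  qed
  have root: "comparable_node p []"
    using assms by (auto simp: comparable_node_def tree_def)
  have "\<exists>s. comparable_node p s \<and> (\<forall>u. comparable_node p u \<longrightarrow> length u \<le> length s)"
    by (rule ex_has_greatest_nat[where k = "[]" and b = "Suc (length t)"])
      (use root bounded in \<open>auto simp: less_Suc_eq_le\<close>)
  then obtain s where s: "comparable_node p s"
    and longest: "\<And>u. comparable_node p u \<Longrightarrow> length u \<le> length s"
    by blast
  have pre: "prefix u s" if "comparable_node p u" for u
    using s longest[OF that] that unfolding comparable_node_def
    by (metis prefix_length_le prefix_length_prefix prefix_order.refl)
  then have "is_stem p s"
    using s unfolding is_stem_def by (meson prefix_order.antisym)
  with pre that show ?thesis by blast
qed

lemma laver_splits:
  assumes "p \<in> laver"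
  shows "\<exists>s\<in>p. infinite (Succ p s)"
  using assms unfolding laver_def is_stem_def comparable_node_def by blast

lemma miller_splits:
  assumes "p \<in> miller"
  shows "\<exists>s\<in>p. infinite (Succ p s)"
  using assms unfolding miller_def tree_def by blast

lemma thin_laver:
  assumes p: "p \<in> laver"
    and B: "\<And>s. s \<in> p \<Longrightarrow> infinite (Succ p s) \<Longrightarrow> B s \<subseteq> Succ p s \<and> infinite (B s)"
  shows "thin p B \<in> laver"
proof -
  obtain s where tree: "tree p" and s: "is_stem p s"
    and inf: "\<And>t. t \<in> p \<Longrightarrow> prefix s t \<Longrightarrow> infinite (Succ p t)"
    using p by (auto simp: laver_def)
  have cs: "s \<in> p" "\<And>t. t \<in> p \<Longrightarrow> prefix s t \<or> prefix t s"
    using s by (auto simp: is_stem_def comparable_node_def)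
  \<comment> \<open>Comparability with \<open>s\<close> leaves \<open>n\<close> as the only
    successor of \<open>u\<close>, so thinning imposes nothing below \<open>s\<close>.\<close>
  have "finite (Succ p u)" if "prefix (u @ [n]) s" for u n
  proof -
    have "m = n" if "m \<in> Succ p u" for m
    proof -
      have "prefix s (u @ [m]) \<or> prefix (u @ [m]) s"
        using cs(2) that unfolding Succ_def by blast
      then have "prefix (u @ [n]) (u @ [m]) \<or> prefix (u @ [m]) s"
        using \<open>prefix (u @ [n]) s\<close> prefix_order.trans by blast
      then show ?thesis
        using \<open>prefix (u @ [n]) s\<close> by (fastforce simp: prefix_def)
    qed
    then have "Succ p u \<subseteq> {n}" by blast
    then show ?thesis using finite_subset by blast
  qed
  then have sq: "s \<in> thin p B"
    using cs(1) by (auto simp: thin_def)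
  then have comp: "comparable_node (thin p B) s"
    using cs(2) thin_subset by (auto simp: comparable_node_def)
  have infq: "infinite (Succ (thin p B) t)" if "t \<in> thin p B" "prefix s t" for t
    using that B inf Succ_thin thin_subset by (metis subsetD)
  \<comment> \<open>The new stem extends the old one, so infinite splitting above the old one
    suffices.\<close>
  obtain s' where s': "is_stem (thin p B) s'" "prefix s s'"
    using is_stem_exists[OF tree_thin[OF tree] sq infq[OF sq]] comp by blast
  then show ?thesis
    using tree_thin[OF tree] infq unfolding laver_def by (auto dest: prefix_order.trans)
qed

lemma thin_miller:
  assumes p: "p \<in> miller"
    and B: "\<And>s. s \<in> p \<Longrightarrow> infinite (Succ p s) \<Longrightarrow> B s \<subseteq> Succ p s \<and> infinite (B s)"
  shows "thin p B \<in> miller"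
proof -
  have tree: "tree p" using p by (simp add: miller_def)
  have ext: "\<exists>t\<in>thin p B. prefix s t \<and> infinite (Succ (thin p B) t)" if s: "s \<in> thin p B" for s
  proof -
    let ?Q = "\<lambda>t. t \<in> p \<and> prefix s t \<and> infinite (Succ p t)"
    have "\<exists>t. ?Q t" using p s thin_subset unfolding miller_def by blast
    \<comment> \<open>For a shortest such \<open>t\<close>, no node from \<open>s\<close> up to but
      excluding \<open>t\<close> splits infinitely, so thinning cannot remove
      \<open>t\<close>.\<close>
    then obtain t where t: "?Q t" and least: "\<And>u. ?Q u \<Longrightarrow> length t \<le> length u"
      using ex_has_least_nat[of ?Q _ length] by blast
    have "n \<in> B u" if u: "prefix (u @ [n]) t" "infinite (Succ p u)" for u n
    proof (cases "prefix (u @ [n]) s")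
      case True
      then show ?thesis using s u by (auto simp: thin_def)
    next
      case False
      then have "prefix s u"
        using t u(1) by (metis prefix_same_cases prefix_snoc)
      moreover have "u \<in> p"
        using tree t u(1) unfolding tree_def by (meson append_prefixD)
      ultimately have "length t \<le> length u" using least u(2) by blast
      with u(1) show ?thesis by (auto dest: prefix_length_le)
    qed
    then have "t \<in> thin p B" using t by (simp add: thin_def)
    then show ?thesis using t B Succ_thin by metis
  qed
  have "[] \<in> thin p B" using tree_thin[OF tree, of B] by (auto simp: tree_def)
  then obtain t where "t \<in> thin p B" "infinite (Succ (thin p B) t)" using ext by blast
  then obtain s where "is_stem (thin p B) s"
    using is_stem_exists tree_thin[OF tree] by blast
  then show ?thesis
    using ext tree_thin[OF tree] unfolding miller_def by blast
qed

section \<open>Collapsing the continuum to \<open>\<hh>\<close>\<close>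

text \<open>Laver and Miller forcing enter the argument only through these two properties, so one
  proof serves both.\<close>

lemma kappa_le_cardinal_h:
  fixes P :: "nat list set set"
  assumes splits: "\<And>p. p \<in> P \<Longrightarrow> \<exists>s\<in>p. infinite (Succ p s)"
    and thin: "\<And>p B. p \<in> P \<Longrightarrow> (\<And>s. s \<in> p \<Longrightarrow> infinite (Succ p s) \<Longrightarrow>
      B s \<subseteq> Succ p s \<and> infinite (B s)) \<Longrightarrow> thin p B \<in> P"
  shows "kappa P (\<subseteq>) \<le>o \<hh>"
proof -
  obtain H where max: "\<forall>A\<in>H. max_antichain A" and no: "\<nexists>R. common_refinement R H"
    and h: "\<hh> = |H|"
    using cardinal_h_welldefined(1) by blast
  have kappa_le: "kappa P (\<subseteq>) \<le>o r"
    if "Card_order r" "collapses P (\<subseteq>) |UNIV :: nat set set| r" for r :: "nat set rel"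
    by (rule kappa_welldefined(3)) (use that in auto)
  show ?thesis
  proof (cases "|UNIV :: nat set set| \<le>o |H|")
    case True
    have "kappa P (\<subseteq>) \<le>o |UNIV :: nat set set|"
      by (rule kappa_le[OF card_of_Card_order], rule collapses_refl) auto
    also note True
    finally show ?thesis using h by simp
  next
    case False
    then have "|H| \<le>o |UNIV :: nat set set|"
      using ordLeq_total[OF card_of_Well_order card_of_Well_order] by blast
    \<comment> \<open>\<open>kappa\<close> ranges over cardinals on sets of subsets of omega, so
      \<open>H\<close> is replaced by its image under the injection \<open>j\<close>.\<close>
    then obtain j :: "pfin set \<Rightarrow> nat set" where j: "inj_on j H"
      using card_of_ordLeq[of H "UNIV :: nat set set"] by blast
    let ?r = "|j ` H|"
    obtain x0 where x0: "x0 \<noteq> bot" and split: "\<And>y. y \<noteq> bot \<Longrightarrow> y \<le> x0 \<Longrightarrow>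
      \<exists>A\<in>H. \<exists>a\<in>A. \<exists>b\<in>A. a \<noteq> b \<and> inf a y \<noteq> bot \<and> inf b y \<noteq> bot"
      by (rule no_common_refinement_splits[OF max no]) blast
    obtain \<R> where R: "\<And>C. C \<in> H \<Longrightarrow> max_antichain (\<R> C)"
      and dir: "\<And>T. T \<subseteq> H \<Longrightarrow> countable T \<Longrightarrow> \<exists>C\<in>H. common_refinement (\<R> C) T"
      by (rule countably_directed_refinements[OF max no h]) blast
    have "\<forall>C. \<exists>g :: pfin \<Rightarrow> nat set. \<forall>x. |UNIV :: nat set set| \<le>o |{e\<in>\<R> C. inf e x \<noteq> bot}| \<longrightarrow>
        (\<forall>z. \<exists>e\<in>\<R> C. inf e x \<noteq> bot \<and> g e = z)"
      using pfin_surjective_colouring by blast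
    then obtain g :: "pfin set \<Rightarrow> pfin \<Rightarrow> nat set" where
      g: "\<And>C x z. |UNIV :: nat set set| \<le>o |{e\<in>\<R> C. inf e x \<noteq> bot}| \<Longrightarrow>
        \<exists>e\<in>\<R> C. inf e x \<noteq> bot \<and> g C e = z"
      by metis
    define separates where "separates T x \<longleftrightarrow> (\<forall>R. common_refinement R T \<longrightarrow>
        |UNIV :: nat set set| \<le>o |{e\<in>R. inf e x \<noteq> bot}| )" for T and x :: pfin
    have "\<exists>T\<subseteq>H. countable T \<and> separates T x" if "x \<noteq> bot" "x \<le> x0" for x
      unfolding separates_def using countable_splitting_family[OF max split that] .
    then obtain T where T: "\<And>x. x \<noteq> bot \<Longrightarrow> x \<le> x0 \<Longrightarrow>
        T x \<subseteq> H \<and> countable (T x) \<and> separates (T x) x"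
      by metis
    obtain X0 where X0: "x0 = abs_pfin X0" by (metis abs_rep_pfin)
    have infX0: "infinite X0" using x0 by (simp add: X0 abs_pfin_eq_bot_iff)
    \<comment> \<open>\<open>E\<close> carries subsets of omega to subsets of \<open>X0\<close>, so
      infinite successor sets become nonzero elements below \<open>x0\<close>.\<close>
    define E where "E = enumerate X0"
    have inj: "inj E"
      unfolding E_def using infX0 by (simp add: strict_mono_enumerate strict_mono_imp_inj_on)
    define y where "y N = abs_pfin (E ` N)" for N
    have y_ne: "y N \<noteq> bot" if "infinite N" for N
      using that inj unfolding y_def abs_pfin_eq_bot_iff by (meson finite_imageD inj_on_subset subset_UNIV)
    have y_le: "y N \<le> x0" for N
      unfolding y_def X0 using infX0 by (intro abs_pfin_mono) (auto simp: E_def enumerate_in_set)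
    have y_mono: "y M \<le> y N" if "M \<subseteq> N" for M N
      unfolding y_def by (rule abs_pfin_mono[OF image_mono[OF that]])
    \<comment> \<open>\<open>inv_into H j a\<close> is the antichain \<open>C\<close> coded by
      \<open>a\<close>. The colour \<open>z\<close> is decided there when every infinite successor
      set is transported below a member of \<open>\<R> C\<close> of colour \<open>z\<close>.\<close>
    define V where "V a z q \<longleftrightarrow> (\<forall>s\<in>q. infinite (Succ q s) \<longrightarrow>
      (\<exists>e\<in>\<R> (inv_into H j a). g (inv_into H j a) e = z \<and> y (Succ q s) \<le> e))" for a z q
    have "collapses P (\<subseteq>) |UNIV :: nat set set| ?r"
    proof (rule collapses_if_decided[where V = V])
      fix a z p q assume V: "V a z q" and "p \<subseteq> q"
      then have "Succ p s \<subseteq> Succ q s" for s by (intro Succ_mono)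
      then show "V a z p"
        using V \<open>p \<subseteq> q\<close> unfolding V_def by (meson finite_subset order_trans subsetD y_mono)
    next
      fix a z z' p assume a: "a \<in> Field ?r" and p: "p \<in> P" and V: "V a z p" "V a z' p"
      let ?C = "inv_into H j a"
      have "?C \<in> H" using a unfolding Field_card_of by (rule inv_into_into)
      obtain s where s: "s \<in> p" "infinite (Succ p s)" using splits[OF p] by blast
      obtain e e' where "e \<in> \<R> ?C" "g ?C e = z" "y (Succ p s) \<le> e"
        "e' \<in> \<R> ?C" "g ?C e' = z'" "y (Succ p s) \<le> e'"
        using V s unfolding V_def by blast
      \<comment> \<open>A single transported infinite successor set is nonzero and below both
        members, so they coincide and so do their colours.\<close>
      then show "z = z'"
        using max_antichain_eqI[OF R[OF \<open>?C \<in> H\<close>]] y_ne[OF s(2)] by blast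
    next
      fix p and z :: "nat set" assume p: "p \<in> P"
      \<comment> \<open>There are only countably many nodes, so one \<open>C\<close> serves all
        infinite successor sets of \<open>p\<close> at once.\<close>
      define TT where "TT = (\<Union>s\<in>{s. infinite (Succ p s)}. T (y (Succ p s)))"
      have "TT \<subseteq> H" using T y_ne y_le by (auto simp: TT_def)
      moreover have "countable TT"
        unfolding TT_def using T y_ne y_le by (intro countable_UN) auto
      ultimately obtain C where C: "C \<in> H" "common_refinement (\<R> C) TT" using dir by blast
      have "\<exists>e\<in>\<R> C. inf e (y (Succ p s)) \<noteq> bot \<and> g C e = z" if s: "infinite (Succ p s)" for s
      proof -
        have "common_refinement (\<R> C) (T (y (Succ p s)))"
          using C(2) s unfolding common_refinement_def TT_def by blast
        then have "|UNIV :: nat set set| \<le>o |{e\<in>\<R> C. inf e (y (Succ p s)) \<noteq> bot}|"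
          using T[OF y_ne[OF s] y_le] unfolding separates_def by blast
        then show ?thesis by (rule g)
      qed
      then obtain e where e: "\<And>s. infinite (Succ p s) \<Longrightarrow>
          e s \<in> \<R> C \<and> inf (e s) (y (Succ p s)) \<noteq> bot \<and> g C (e s) = z"
        by metis
      \<comment> \<open>Since \<open>e s\<close> meets the transported successor set, infinitely
        many successors are mapped into its representative; keeping only these puts the set below
        \<open>e s\<close>.\<close>
      define B where "B s = {n \<in> Succ p s. E n \<in> rep_pfin (e s)}" for s
      have B: "B s \<subseteq> Succ p s \<and> infinite (B s)" if s: "infinite (Succ p s)" for s
      proof -
        have "inf (e s) (y (Succ p s)) = abs_pfin (rep_pfin (e s) \<inter> E ` Succ p s)"
          unfolding y_def by (metis abs_rep_pfin inf_pfin.abs_eq)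
        also have "rep_pfin (e s) \<inter> E ` Succ p s = E ` B s" by (auto simp: B_def)
        finally have "infinite (E ` B s)" using e[OF s] by (simp add: abs_pfin_eq_bot_iff)
        then show ?thesis by (auto simp: B_def)
      qed
      have yB: "y (B s) \<le> e s" for s
      proof -
        have "E ` B s \<subseteq> rep_pfin (e s)" by (auto simp: B_def)
        then show ?thesis unfolding y_def by (metis abs_rep_pfin abs_pfin_mono)
      qed
      have "V (j C) z (thin p B)"
        unfolding V_def inv_into_f_f[OF j C(1)]
      proof (intro ballI impI)
        fix s assume "infinite (Succ (thin p B) s)"
        then have s: "infinite (Succ p s)"
          using finite_subset[OF Succ_mono[OF thin_subset]] by blast
        have "y (Succ (thin p B) s) \<le> e s"
          by (rule order_trans[OF y_mono[OF Succ_thin_subset[OF s]] yB])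
        then show "\<exists>e\<in>\<R> C. g C e = z \<and> y (Succ (thin p B) s) \<le> e" using e[OF s] by blast
      qed
      moreover have "thin p B \<in> P" using thin[OF p] B by blast
      ultimately show "\<exists>a\<in>Field ?r. \<exists>q\<in>P. q \<subseteq> p \<and> V a z q"
        using thin_subset C(1) unfolding Field_card_of by blast
    qed (auto simp: Field_card_of)
    then have "kappa P (\<subseteq>) \<le>o ?r" by (intro kappa_le card_of_Card_order)
    also have "?r \<le>o |H|" by (rule card_of_image)
    finally show ?thesis using h by simp
  qed
qed

theorem theorem2p7:
  "kappa laver (\<subseteq>) \<le>o \<hh> \<and> kappa miller (\<subseteq>) \<le>o \<hh>"
proof
  show "kappa laver (\<subseteq>) \<le>o \<hh>"
    by (rule kappa_le_cardinal_h) (fact laver_splits, rule thin_laver)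
  show "kappa miller (\<subseteq>) \<le>o \<hh>"
    by (rule kappa_le_cardinal_h) (fact miller_splits, rule thin_miller)
qed

end
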